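(* For every prime $p$ and every integer $r\geq 1$, $$M(p^r)=\begin{cases}p-1, & r=1,\\ p^{r-2}(p^2-p+1), & r>1.\end{cases}$$
   Context: For a polynomial $f\in\mathbb{Z}[X]$ and an integer $m\geq 1$, $(f\bmod m)$ denotes the function $\mathbb{Z}/m\mathbb{Z}\to\mathbb{Z}/m\mathbb{Z}$, $a\mapsto f(a)$, induced by $f$. Its value set (image) is $V(f\bmod m)\subseteq\mathbb{Z}/m\mathbb{Z}$, and $N(f,m)=\#V(f\bmod m)$. One says $(f\bmod m)$ is a permutation (or $f$ is a permutation over $\mathbb{Z}/m\mathbb{Z}$) if this induced function is bijective, equivalently $N(f,m)=m$. Define $$M(m)=\max\{N(f,m)\ |\ f\in\mathbb{Z}[X],\ (f\bmod m)\text{ is not a permutation}\}.$$ *)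

theory Defs
  imports
    "HOL-Number_Theory.Residues"
    "HOL-Computational_Algebra.Polynomial"
begin

(* Z/mZ is represented by the least non-negative residues, i.e. by the carrier {0..m-1} of the
   library's residue_ring m. The lemma poly_fun_mod_cong below shows that the choice of
   representatives does not matter. *)

abbreviation Zmod :: "nat \<Rightarrow> int set"
  where "Zmod m \<equiv> carrier (residue_ring (int m))"

definition poly_fun_mod :: "int poly \<Rightarrow> nat \<Rightarrow> int \<Rightarrow> int"
  where "poly_fun_mod f m a = poly f a mod int m"

definition value_set :: "int poly \<Rightarrow> nat \<Rightarrow> int set"
  where "value_set f m = poly_fun_mod f m ` Zmod m"

definition num_values :: "int poly \<Rightarrow> nat \<Rightarrow> nat"
  where "num_values f m = card (value_set f m)"

definition permutation_mod :: "int poly \<Rightarrow> nat \<Rightarrow> bool"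
  where "permutation_mod f m \<longleftrightarrow> bij_betw (poly_fun_mod f m) (Zmod m) (Zmod m)"

(* The maximum exists for every m > 1; see the lemmas below. For m = 1 every
   polynomial is a permutation, so the set is empty and Max is unspecified. *)

definition max_nonperm :: "nat \<Rightarrow> nat"
  where "max_nonperm m = Max {num_values f m | f. \<not> permutation_mod f m}"

lemma poly_fun_mod_cong:
  assumes "[a = b] (mod int m)"
  shows "poly_fun_mod f m a = poly_fun_mod f m b"
proof -
  have "[poly f a = poly f b] (mod int m)"
    by (induction f) (simp_all add: cong_add cong_mult assms)
  then show ?thesis
    by (simp add: poly_fun_mod_def cong_def)
qed

lemma Zmod_eq: "Zmod m = {0..<int m}"
  by (auto simp: residue_ring_def)

lemma finite_num_values_nonperm: "finite {num_values f m | f. \<not> permutation_mod f m}"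
proof (rule finite_subset)
  have "num_values f m \<le> m" for f
    using card_image_le[of "{0..<int m}" "poly_fun_mod f m"]
    by (simp add: num_values_def value_set_def Zmod_eq)
  then show "{num_values f m | f. \<not> permutation_mod f m} \<subseteq> {..m}"
    by blast
qed simp

lemma num_values_nonperm_nonempty:
  assumes "m > 1"
  shows "{num_values f m | f. \<not> permutation_mod f m} \<noteq> {}"
proof -
  have "\<not> inj_on (poly_fun_mod 0 m) {0..<int m}"
  proof
    assume "inj_on (poly_fun_mod 0 m) {0..<int m}"
    then have "(0::int) = 1"
      by (rule inj_onD) (use assms in \<open>simp_all add: poly_fun_mod_def\<close>)
    then show False by simp
  qed
  then have "\<not> permutation_mod 0 m"
    unfolding permutation_mod_def Zmod_eq bij_betw_def by blast
  then show ?thesis by blast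
qed

lemma permutation_mod_iff_num_values:
  assumes "m \<ge> 1"
  shows "permutation_mod f m \<longleftrightarrow> num_values f m = m"
proof -
  let ?g = "poly_fun_mod f m" and ?A = "{0..<int m}"
  have sub: "?g ` ?A \<subseteq> ?A"
    using assms by (auto simp: poly_fun_mod_def)
  have "?g ` ?A = ?A" if "inj_on ?g ?A"
    by (rule endo_inj_surj) (use sub that in simp_all)
  then have "bij_betw ?g ?A ?A \<longleftrightarrow> inj_on ?g ?A"
    unfolding bij_betw_def by blast
  also have "\<dots> \<longleftrightarrow> card (?g ` ?A) = card ?A"
    by (rule inj_on_iff_eq_card) simp
  finally show ?thesis
    by (simp add: permutation_mod_def num_values_def value_set_def Zmod_eq)
qed

end

theory Submission
  imports Defs
begin

(* By Taylor expansion, f (x + d) = f x + d * f' x modulo d^2.  Hence if f permutes Z/p and f' has no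
   zero modulo p, then f permutes Z/p^r for every r.  If f is not a permutation modulo p, it misses a
   residue class modulo p; if f' vanishes at a modulo p, then f is constant modulo p^2 on the class
   of a modulo p, so that it takes at most p^2 - p + 1 values modulo p^2.  Each value modulo p^2
   lifts to at most p^(r - 2) values modulo p^r.

   For r > 1 the bound is attained by f = X^(2p - 1) + p X.  It induces the identity modulo p, and
   f' is -1 at the units modulo p, so f is injective on the units modulo p^r.  Moreover
   f (p t) = p^2 (t + p^(2p - 3) t^(2p - 1)), where the factor in brackets is a permutation modulo
   p^(r - 2).  For r = 1 the polynomial X + 1 - X^(p - 1) fixes the units and sends 0 to 1. *)

section \<open>Taylor expansion and differences of polynomial values\<close>

lemma poly_taylor1:
  fixes f :: "'a::idom poly"
  shows "\<exists>k. poly f (x + d) = poly f x + d * poly (pderiv f) x + d ^ 2 * k"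
proof (induction f)
  case 0
  show ?case by simp
next
  case (pCons a f)
  then obtain k where k: "poly f (x + d) = poly f x + d * poly (pderiv f) x + d ^ 2 * k"
    by blast
  have "poly (pCons a f) (x + d) = poly (pCons a f) x + d * poly (pderiv (pCons a f)) x
          + d ^ 2 * (poly (pderiv f) x + (x + d) * k)"
    unfolding pderiv_pCons poly_pCons poly_add k by (simp add: algebra_simps power2_eq_square)
  then show ?case by blast
qed

text \<open>Taylor expansion at \<open>y\<close> splits \<open>x - y\<close> off the difference of
  the values. Since \<open>p\<close> divides \<open>x - y\<close> but not the derivative, the
  cofactor is prime to \<open>p\<close>, so the whole power \<open>p ^ k\<close> must divide
  \<open>x - y\<close>.\<close>

lemma dvd_diff_of_dvd_poly_diff:
  fixes f :: "int poly" and p :: int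
  assumes "prime p" and "p dvd x - y" and "\<not> p dvd poly (pderiv f) y"
    and "p ^ k dvd poly f x - poly f y"
  shows "p ^ k dvd x - y"
proof -
  obtain c where "poly f (y + (x - y)) = poly f y + (x - y) * poly (pderiv f) y + (x - y) ^ 2 * c"
    using poly_taylor1 by blast
  then have eq: "poly f x - poly f y = (x - y) * (poly (pderiv f) y + (x - y) * c)"
    by (simp add: algebra_simps power2_eq_square)
  have "\<not> p dvd poly (pderiv f) y + (x - y) * c"
    using assms(2,3) by (simp add: dvd_add_left_iff)
  then have "coprime (p ^ k) (poly (pderiv f) y + (x - y) * c)"
    using assms(1) by (simp add: prime_imp_coprime)
  then show ?thesis
    using assms(4) eq by (simp add: coprime_dvd_mult_left_iff)
qed

section \<open>Equality of values as divisibility, and counting of values\<close>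

lemma carrier_residue_ring: "carrier (residue_ring n) = {0..<n}"
  by (auto simp: residue_ring_def)

lemma poly_fun_mod_eq_iff:
  "poly_fun_mod f m x = poly_fun_mod f m y \<longleftrightarrow> int m dvd poly f x - poly f y"
  by (simp add: poly_fun_mod_def mod_eq_dvd_iff)

lemma Zmod_eqI:
  assumes "x \<in> Zmod m" and "y \<in> Zmod m" and "int m dvd x - y"
  shows "x = y"
  using assms by (metis carrier_residue_ring atLeastLessThan_iff mod_eq_dvd_iff mod_pos_pos_trivial)

lemma not_permutation_modI:
  assumes "x \<in> Zmod m" and "y \<in> Zmod m" and "x \<noteq> y" and "int m dvd poly f x - poly f y"
  shows "\<not> permutation_mod f m"
  using assms unfolding permutation_mod_def bij_betw_def inj_on_def poly_fun_mod_eq_iff by blast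

lemma permutation_modI:
  assumes "m \<ge> 1" and "inj_on (poly_fun_mod f m) (Zmod m)"
  shows "permutation_mod f m"
  using assms by (simp add: permutation_mod_iff_num_values num_values_def value_set_def card_image
      carrier_residue_ring)

text \<open>Injectivity on the least residues passes to arbitrary integers, since a value depends
  only on the residue class of the argument.\<close>

lemma permutation_modD:
  assumes "m \<ge> 1" and "permutation_mod f m" and "int m dvd poly f x - poly f y"
  shows "int m dvd x - y"
proof -
  have "poly_fun_mod f m (x mod int m) = poly_fun_mod f m x"
    and "poly_fun_mod f m (y mod int m) = poly_fun_mod f m y"
    by (intro poly_fun_mod_cong; simp add: cong_def)+
  then have "poly_fun_mod f m (x mod int m) = poly_fun_mod f m (y mod int m)"
    using assms(3) by (metis poly_fun_mod_eq_iff)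
  moreover have "x mod int m \<in> Zmod m" "y mod int m \<in> Zmod m"
    using assms(1) by (auto simp: carrier_residue_ring)
  ultimately have "x mod int m = y mod int m"
    using assms(2) unfolding permutation_mod_def bij_betw_def inj_on_def by blast
  then show ?thesis by (simp add: mod_eq_dvd_iff)
qed

lemma num_values_ge_card:
  assumes "S \<subseteq> Zmod m" and "inj_on (poly_fun_mod f m) S"
  shows "card S \<le> num_values f m"
proof -
  have "card S = card (poly_fun_mod f m ` S)"
    using assms(2) by (simp add: card_image)
  also have "\<dots> \<le> num_values f m"
    unfolding num_values_def value_set_def
    using assms(1) by (intro card_mono image_mono) (simp_all add: carrier_residue_ring)
  finally show ?thesis .
qed

lemma num_values_le: "num_values f m \<le> m"
  using card_image_le[of "{0..<int m}" "poly_fun_mod f m"]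
  by (simp add: num_values_def value_set_def carrier_residue_ring)

lemma num_values_nonperm_le:
  assumes "m \<ge> 1" and "\<not> permutation_mod f m"
  shows "num_values f m \<le> m - 1"
  using assms num_values_le[of f m] by (simp add: permutation_mod_iff_num_values)

text \<open>A value modulo \<open>m * n\<close> is determined by its quotient and remainder on
  division by \<open>m\<close>. The quotient has at most \<open>n\<close> possibilities, and the
  remainder is a value of \<open>f\<close> modulo \<open>m\<close>.\<close>

lemma num_values_mult_le:
  assumes "m \<ge> 1" and "n \<ge> 1"
  shows "num_values f (m * n) \<le> n * num_values f m"
proof -
  let ?h = "\<lambda>v. (v div int m, v mod int m)"
  have "?h ` value_set f (m * n) \<subseteq> {0..<int n} \<times> value_set f m"
  proof clarify
    fix v assume "v \<in> value_set f (m * n)"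
    then obtain x where v: "v = poly f x mod (int m * int n)"
      by (auto simp: value_set_def poly_fun_mod_def)
    have "0 \<le> v" "v < int n * int m"
      using assms v by (simp_all add: mult.commute[of "int n"])
    moreover have "v div int m * int m \<le> v"
      using assms(1) by (simp add: minus_mod_eq_div_mult [symmetric])
    ultimately have "0 \<le> v div int m" "v div int m < int n"
      using assms(1) by (simp_all add: pos_imp_zdiv_nonneg_iff)
        (meson le_less_trans mult_less_cancel_right_disj of_nat_0_le_iff not_le)
    moreover have "v mod int m = poly_fun_mod f m (x mod int m)"
      using poly_fun_mod_cong[of "x mod int m" x m f]
      by (simp add: v poly_fun_mod_def cong_def mod_mod_cancel)
    ultimately show "v div int m \<in> {0..<int n} \<and> v mod int m \<in> value_set f m"
      using assms by (auto simp: value_set_def carrier_residue_ring)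
  qed
  moreover have "inj_on ?h (value_set f (m * n))"
  proof (rule inj_onI)
    fix v w assume "?h v = ?h w"
    then have "v div int m * int m + v mod int m = w div int m * int m + w mod int m"
      by simp
    then show "v = w"
      by (simp only: div_mult_mod_eq)
  qed
  ultimately have "card (value_set f (m * n)) \<le> card ({0..<int n} \<times> value_set f m)"
    by (intro card_inj_on_le[of ?h]) (simp_all add: value_set_def carrier_residue_ring)
  then show ?thesis
    by (simp add: num_values_def card_cartesian_product)
qed

section \<open>Upper bound for non-permutations modulo prime powers\<close>

lemma num_values_prime_square_critical_le:
  fixes p :: nat
  assumes "p \<ge> 1" and "int p dvd poly (pderiv f) a"
  shows "num_values f (p ^ 2) \<le> p ^ 2 - p + 1"
proof -
  define b where "b = a mod int p"
  \<comment> \<open>\<open>A\<close> is the residue class of \<open>a\<close> modulo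
    \<open>p\<close>, seen inside \<open>Zmod (p ^ 2)\<close>.\<close>
  define A where "A = (\<lambda>t. b + int p * t) ` {0..<int p}"
  have b: "0 \<le> b" "b < int p"
    using assms(1) by (simp_all add: b_def)
  have card_A: "card A = p"
    unfolding A_def using assms(1) by (subst card_image) (auto simp: inj_on_def)
  have A_sub: "A \<subseteq> Zmod (p ^ 2)"
  proof
    fix x assume "x \<in> A"
    then obtain t where t: "0 \<le> t" "t < int p" "x = b + int p * t"
      by (auto simp: A_def)
    have "x < int p * (t + 1)"
      using b t by (simp add: algebra_simps)
    also have "\<dots> \<le> int p * int p"
      using t by (intro mult_left_mono) auto
    finally show "x \<in> Zmod (p ^ 2)"
      using b t by (simp add: carrier_residue_ring power2_eq_square)
  qed
  \<comment> \<open>On this class the increment is a multiple of \<open>p\<close>, and so is the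
    derivative at \<open>a\<close>. Hence the linear and the quadratic Taylor terms are both
    divisible by \<open>p ^ 2\<close>.\<close>
  have const: "poly_fun_mod f (p ^ 2) x = poly_fun_mod f (p ^ 2) a" if "x \<in> A" for x
  proof -
    have "int p dvd x - a"
      using that by (auto simp: A_def b_def mod_eq_dvd_iff [symmetric])
    then obtain d where d: "x = a + int p * d"
      by (metis add.commute diff_add_cancel dvdE)
    obtain e where e: "poly (pderiv f) a = int p * e"
      using assms(2) by blast
    obtain k where "poly f (a + int p * d)
        = poly f a + (int p * d) * poly (pderiv f) a + (int p * d) ^ 2 * k"
      using poly_taylor1 by blast
    then have "poly f x - poly f a = int p ^ 2 * (d * e + d ^ 2 * k)"
      by (simp add: d e algebra_simps power2_eq_square)
    then show ?thesis
      by (simp add: poly_fun_mod_eq_iff)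
  qed
  \<comment> \<open>The class \<open>A\<close> contributes a single value, and the points outside it
    at most \<open>p ^ 2 - p\<close> further ones.\<close>
  have "value_set f (p ^ 2)
      \<subseteq> insert (poly_fun_mod f (p ^ 2) a) (poly_fun_mod f (p ^ 2) ` (Zmod (p ^ 2) - A))"
    using const by (auto simp: value_set_def)
  then have "num_values f (p ^ 2)
      \<le> card (insert (poly_fun_mod f (p ^ 2) a) (poly_fun_mod f (p ^ 2) ` (Zmod (p ^ 2) - A)))"
    unfolding num_values_def by (intro card_mono) (simp_all add: carrier_residue_ring)
  also have "\<dots> \<le> Suc (card (poly_fun_mod f (p ^ 2) ` (Zmod (p ^ 2) - A)))"
    by (simp add: card_insert_if carrier_residue_ring)
  also have "\<dots> \<le> Suc (card (Zmod (p ^ 2) - A))"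
    by (simp add: card_image_le carrier_residue_ring)
  also have "card (Zmod (p ^ 2) - A) = p ^ 2 - p"
    using A_sub card_A
    by (subst card_Diff_subset) (auto simp: carrier_residue_ring finite_subset A_def nat_power_eq)
  finally show ?thesis by simp
qed

text \<open>Points with equal values modulo \<open>p ^ r\<close> are congruent modulo
  \<open>p\<close> by the permutation hypothesis, and the non-vanishing derivative lifts this to
  \<open>p ^ r\<close>. The modulus \<open>p ^ 0\<close> is treated apart because equal values
  modulo 1 say nothing modulo \<open>p\<close>.\<close>

lemma permutation_mod_prime_powerI:
  fixes p :: nat
  assumes "prime p" and "permutation_mod f p" and "\<And>a. \<not> int p dvd poly (pderiv f) a"
  shows "permutation_mod f (p ^ r)"
proof (cases "r = 0")
  case True
  then show ?thesis
    by (intro permutation_modI) (simp_all add: carrier_residue_ring inj_on_def)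
next
  case False
  have p: "p \<ge> 1"
    using assms(1) prime_ge_1_nat by blast
  show ?thesis
  proof (intro permutation_modI inj_onI)
    fix x y assume xy: "x \<in> Zmod (p ^ r)" "y \<in> Zmod (p ^ r)"
      "poly_fun_mod f (p ^ r) x = poly_fun_mod f (p ^ r) y"
    then have dvd: "int p ^ r dvd poly f x - poly f y"
      by (simp add: poly_fun_mod_eq_iff)
    then have "int p dvd poly f x - poly f y"
      using False by (meson dvd_power dvd_trans neq0_conv)
    then have "int p dvd x - y"
      using permutation_modD p assms(2) by blast
    then have "int p ^ r dvd x - y"
      using dvd_diff_of_dvd_poly_diff dvd assms(1,3) by (metis prime_nat_int_transfer)
    then show "x = y"
      using Zmod_eqI[OF xy(1,2)] by simp
  qed (use p in simp)
qed

lemma num_values_prime_power_nonperm_le: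
  fixes p :: nat
  assumes "prime p" and "r \<ge> 2" and "\<not> permutation_mod f (p ^ r)"
  shows "num_values f (p ^ r) \<le> p ^ (r - 2) * (p ^ 2 - p + 1)"
proof -
  have p: "p \<ge> 1"
    using assms(1) prime_ge_1_nat by blast
  have "num_values f (p ^ 2) \<le> p ^ 2 - p + 1"
  proof (cases "permutation_mod f p")
    case True
    then obtain a where "int p dvd poly (pderiv f) a"
      using permutation_mod_prime_powerI assms(1,3) by blast
    then show ?thesis
      by (rule num_values_prime_square_critical_le[OF p])
  next
    \<comment> \<open>Missing a residue class modulo \<open>p\<close> costs \<open>p\<close> values
      modulo \<open>p ^ 2\<close>, so this case stays one below the bound.\<close>
    case False
    have "num_values f (p ^ 2) \<le> p * num_values f p"
      using num_values_mult_le[OF p p] by (simp add: power2_eq_square)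
    also have "\<dots> \<le> p * (p - 1)"
      using num_values_nonperm_le[OF p False] by (intro mult_left_mono) auto
    finally show ?thesis
      by (simp add: power2_eq_square diff_mult_distrib2)
  qed
  moreover have "num_values f (p ^ r) \<le> p ^ (r - 2) * num_values f (p ^ 2)"
    using num_values_mult_le[of "p ^ 2" "p ^ (r - 2)" f] p assms(2)
    by (metis le_add_diff_inverse one_le_power power_add)
  ultimately show ?thesis
    by (meson le_trans mult_le_mono2)
qed

section \<open>Fermat's little theorem and the maximum for a prime modulus\<close>

lemma max_nonperm_eqI:
  assumes "\<not> permutation_mod f m" and "k \<le> num_values f m"
    and "\<And>g. \<not> permutation_mod g m \<Longrightarrow> num_values g m \<le> k"
  shows "max_nonperm m = k"
proof -
  have "num_values f m = k"
    using assms by (meson antisym)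
  then show ?thesis
    unfolding max_nonperm_def using assms finite_num_values_nonperm[of m]
    by (intro Max_eqI) auto
qed

lemma fermat_dvd:
  fixes p :: nat
  assumes "prime p" and "\<not> int p dvd x"
  shows "int p dvd x ^ (p - 1) - 1"
proof -
  define a where "a = nat (x mod int p)"
  have a: "int a = x mod int p"
    using prime_gt_0_nat[OF assms(1)] by (simp add: a_def)
  then have "\<not> p dvd a"
    using assms(2) by (metis dvd_mod_iff dvd_refl int_dvd_int_iff)
  then have "[int (a ^ (p - 1)) = int 1] (mod int p)"
    using fermat_theorem[OF assms(1)] cong_int_iff by blast
  then have "[(x mod int p) ^ (p - 1) = 1] (mod int p)"
    by (simp add: a)
  then show ?thesis
    by (simp add: cong_def power_mod mod_eq_dvd_iff)
qed

lemma max_nonperm_prime: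
  fixes p :: nat
  assumes "prime p"
  shows "max_nonperm p = p - 1"
proof -
  define f :: "int poly" where "f = [:1, 1:] - monom 1 (p - 1)"
  have p: "p \<ge> 2"
    using assms prime_ge_2_nat by blast
  have poly_f: "poly f x = 1 + x - x ^ (p - 1)" for x
    by (simp add: f_def poly_monom)
  show ?thesis
  proof (rule max_nonperm_eqI)
    \<comment> \<open>The points 0 and 1 collide: both have value 1.\<close>
    show "\<not> permutation_mod f p"
      using p by (intro not_permutation_modI[of 0 p 1])
        (simp_all add: carrier_residue_ring poly_f power_0_left)
    have "inj_on (poly_fun_mod f p) {1..<int p}"
    proof (rule inj_onI)
      fix x y assume xy: "x \<in> {1..<int p}" "y \<in> {1..<int p}"
        "poly_fun_mod f p x = poly_fun_mod f p y"
      then have "\<not> int p dvd x" "\<not> int p dvd y"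
        by (auto dest: zdvd_imp_le)
      then have "int p dvd x ^ (p - 1) - 1" "int p dvd y ^ (p - 1) - 1"
        using fermat_dvd assms by auto
      moreover have "int p dvd poly f x - poly f y"
        using xy by (simp add: poly_fun_mod_eq_iff)
      \<comment> \<open>The Fermat terms cancel the powers occurring in \<open>f\<close>, which
        leaves \<open>x - y\<close>.\<close>
      ultimately have "int p dvd (poly f x - poly f y) + (x ^ (p - 1) - 1) - (y ^ (p - 1) - 1)"
        by (blast intro: dvd_diff[OF dvd_add])
      then have "int p dvd x - y"
        by (simp add: poly_f algebra_simps)
      then show "x = y"
        using xy by (intro Zmod_eqI[of x p y]) (simp_all add: carrier_residue_ring)
    qed
    then have "card {1..<int p} \<le> num_values f p"
      by (intro num_values_ge_card) (auto simp: carrier_residue_ring)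
    then show "p - 1 \<le> num_values f p"
      by (simp add: nat_diff_distrib)
  next
    show "num_values g p \<le> p - 1" if "\<not> permutation_mod g p" for g
      using num_values_nonperm_le that p by simp
  qed
qed

section \<open>The maximum for higher prime powers\<close>

lemma card_Zmod_prime_power_units:
  fixes p :: nat
  assumes "p \<ge> 1" and "r \<ge> 1"
  shows "card {x \<in> Zmod (p ^ r). \<not> int p dvd x} = p ^ r - p ^ (r - 1)"
proof -
  have pr: "int p ^ r = int p * int p ^ (r - 1)"
    using assms(2) by (cases r) simp_all
  define B where "B = (\<lambda>t. int p * t) ` {0..<int (p ^ (r - 1))}"
  have "{x \<in> Zmod (p ^ r). int p dvd x} = B"
    using assms(1) by (auto simp: B_def carrier_residue_ring pr zero_le_mult_iff elim!: dvdE)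
  then have "{x \<in> Zmod (p ^ r). \<not> int p dvd x} = Zmod (p ^ r) - B" "B \<subseteq> Zmod (p ^ r)"
    by auto
  moreover have "card B = p ^ (r - 1)"
    unfolding B_def using assms(1) by (subst card_image) (auto simp: inj_on_def nat_power_eq)
  moreover have "finite B" by (simp add: B_def)
  ultimately show ?thesis
    by (simp add: card_Diff_subset carrier_residue_ring nat_power_eq)
qed

lemma max_nonperm_prime_power:
  fixes p :: nat
  assumes "prime p" and "r \<ge> 2"
  shows "max_nonperm (p ^ r) = p ^ (r - 2) * (p ^ 2 - p + 1)"
proof -
  define f :: "int poly" where "f = monom 1 (2 * p - 1) + monom (int p) 1"
  \<comment> \<open>\<open>f\<close> will be injective on \<open>U \<union> W\<close>, whose size is
    the claimed maximum. At multiples of \<open>p\<close> the values are multiples of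
    \<open>p ^ 2\<close>, which leaves room for only \<open>p ^ (r - 2)\<close> of them; this is the
    size of \<open>W\<close>.\<close>
  define U where "U = {x \<in> Zmod (p ^ r). \<not> int p dvd x}"
  define W where "W = (\<lambda>t. int p * t) ` {0..<int (p ^ (r - 2))}"
  have p: "p \<ge> 2"
    using assms(1) prime_ge_2_nat by blast
  have prime: "prime (int p)"
    using assms(1) by simp
  \<comment> \<open>Writing the exponents as \<open>q + 3\<close> and \<open>q + 2\<close> avoids
    truncated subtraction, and shows that \<open>x ^ (2 * p - 1)\<close> at a multiple of
    \<open>p\<close> is divisible by \<open>p ^ 3\<close>.\<close>
  define q where "q = 2 * p - 4"
  have q: "2 * p - 1 = q + 3" "2 * p - 2 = q + 2"
    using p by (simp_all add: q_def)
  have poly_f: "poly f x = x ^ (2 * p - 1) + int p * x" for x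
    by (simp add: f_def poly_monom)
  have poly_f': "poly (pderiv f) x = (2 * int p - 1) * x ^ (2 * p - 2) + int p" for x
    using p by (simp add: f_def poly_monom pderiv_add pderiv_monom of_nat_diff numeral_2_eq_2)
  have f_mod_p: "int p dvd poly f x - x" for x
  proof -
    have "int p dvd x ^ (2 * p - 1) - x"
    proof (cases "int p dvd x")
      case True
      then show ?thesis using q(1) by (simp add: power_add power3_eq_cube)
    next
      case False
      \<comment> \<open>A difference of squares exhibits the factor to which Fermat's theorem
        applies.\<close>
      have "x ^ (2 * p - 1) - x = x * (x ^ (p - 1) + 1) * (x ^ (p - 1) - 1)"
      proof -
        have "2 * p - 1 = Suc ((p - 1) + (p - 1))"
          using p by simp
        then have "x ^ (2 * p - 1) = x * (x ^ (p - 1) * x ^ (p - 1))"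
          by (simp only: power_Suc power_add)
        then show ?thesis by (simp add: algebra_simps)
      qed
      then show ?thesis
        using fermat_dvd[OF assms(1) False] by simp
    qed
    then have "int p dvd (x ^ (2 * p - 1) - x) + int p * x" by simp
    then show ?thesis by (simp add: poly_f algebra_simps)
  qed
  have inj_mod_p: "int p dvd x - y" if "int p ^ r dvd poly f x - poly f y" for x y
  proof -
    have "int p dvd poly f x - poly f y"
      by (rule dvd_trans[OF _ that]) (use assms(2) in simp)
    then have "int p dvd (poly f x - poly f y) - (poly f x - x) + (poly f y - y)"
      using f_mod_p by (blast intro: dvd_add[OF dvd_diff])
    then show ?thesis by simp
  qed
  have inj_U: "int p ^ r dvd x - y" if "\<not> int p dvd y" "int p ^ r dvd poly f x - poly f y" for x y
  proof (rule dvd_diff_of_dvd_poly_diff[OF prime _ _ that(2)])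
    show "int p dvd x - y"
      using inj_mod_p that by blast
    have "\<not> int p dvd y ^ (2 * p - 2)"
      using that(1) prime prime_dvd_power by blast
    moreover have "int p dvd y ^ (2 * p - 2)" if "int p dvd poly (pderiv f) y"
    proof -
      \<comment> \<open>Modulo \<open>p\<close> the derivative is the negative of this power, so it
        cannot vanish at a unit.\<close>
      have "y ^ (2 * p - 2) = int p * (2 * y ^ (2 * p - 2) + 1) - poly (pderiv f) y"
        by (simp add: poly_f' algebra_simps)
      then show ?thesis using that by (metis dvd_diff dvd_triv_left)
    qed
    ultimately show "\<not> int p dvd poly (pderiv f) y" by blast
  qed
  \<comment> \<open>After division by \<open>p ^ 2\<close>, the difference of the values is
    \<open>s - t\<close> times a factor congruent to 1 modulo \<open>p\<close>, and that factor can
    be cancelled.\<close>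
  have inj_W: "int p ^ (r - 2) dvd s - t"
    if "int p ^ r dvd poly f (int p * s) - poly f (int p * t)" for s t
  proof -
    have "s - t dvd s ^ (q + 3) - t ^ (q + 3)"
      by (metis power_diff_sumr2 dvd_triv_left)
    then obtain k where k: "s ^ (q + 3) - t ^ (q + 3) = (s - t) * k" by blast
    have "poly f (int p * s) - poly f (int p * t)
        = int p ^ 2 * (int p ^ (q + 1) * (s ^ (q + 3) - t ^ (q + 3)) + (s - t))"
      unfolding poly_f q(1)
      by (simp add: power_mult_distrib power_add algebra_simps power2_eq_square power3_eq_cube)
    also have "\<dots> = int p ^ 2 * ((s - t) * (int p * (int p ^ q * k) + 1))"
      by (simp add: k algebra_simps)
    finally have "int p ^ 2 * int p ^ (r - 2) dvd int p ^ 2 * ((s - t) * (int p * (int p ^ q * k) + 1))"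
      using that assms(2) by (metis le_add_diff_inverse power_add)
    then have "int p ^ (r - 2) dvd (s - t) * (int p * (int p ^ q * k) + 1)"
      using p by (subst (asm) dvd_mult_cancel_left) simp
    moreover have "\<not> int p dvd int p * (int p ^ q * k) + 1"
      using p by (simp add: dvd_add_right_iff)
    then have "coprime (int p ^ (r - 2)) (int p * (int p ^ q * k) + 1)"
      using prime prime_imp_coprime by (meson coprime_power_left_iff)
    ultimately show ?thesis
      by (simp add: coprime_dvd_mult_left_iff)
  qed
  have pr: "p ^ r = p ^ 2 * p ^ (r - 2)" "p ^ (r - 1) = p * p ^ (r - 2)"
    using assms(2) by (metis le_add_diff_inverse power_add,
      metis Suc_diff_Suc Suc_1 Suc_le_lessD power_Suc)
  have W_sub: "W \<subseteq> Zmod (p ^ r)"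
  proof
    fix x assume "x \<in> W"
    then obtain t where t: "0 \<le> t" "t < int (p ^ (r - 2))" "x = int p * t"
      by (auto simp: W_def)
    have "int p * t < int p * int (p ^ (r - 2))"
      using t p by simp
    also have "\<dots> = int (p ^ (r - 1))" unfolding pr(2) by simp
    also have "\<dots> \<le> int (p ^ r)"
      using p by (simp add: power_increasing)
    finally show "x \<in> Zmod (p ^ r)"
      using t by (simp add: carrier_residue_ring)
  qed
  show ?thesis
  proof (rule max_nonperm_eqI)
    \<comment> \<open>The nonzero residue \<open>p ^ (r - 1)\<close> collides with 0: the linear
      term becomes a multiple of \<open>p ^ r\<close>, and so does the power, because
      \<open>r \<ge> 2\<close> gives \<open>3 * (r - 1) \<ge> r\<close>.\<close>
    have "int (p ^ r) dvd poly f (int p ^ (r - 1)) - poly f 0"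
    proof -
      have "r \<le> (r - 1) * (2 * p - 1)"
      proof -
        have "r \<le> (r - 1) * 3" using assms(2) by simp
        also have "\<dots> \<le> (r - 1) * (2 * p - 1)" using p by (intro mult_left_mono) auto
        finally show ?thesis .
      qed
      then have "int p ^ r dvd (int p ^ (r - 1)) ^ (2 * p - 1)"
        by (simp add: le_imp_power_dvd flip: power_mult)
      moreover have "int p * int p ^ (r - 1) = int p ^ r"
        using assms(2) by (simp flip: power_Suc)
      ultimately show ?thesis
        using q(1) by (simp add: poly_f power_0_left)
    qed
    then show "\<not> permutation_mod f (p ^ r)"
      using p assms(2) by (intro not_permutation_modI[of "int p ^ (r - 1)" _ 0])
        (simp_all add: carrier_residue_ring power_strict_increasing)
    have "inj_on (poly_fun_mod f (p ^ r)) (U \<union> W)"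
    proof (rule inj_onI)
      fix x y assume xy: "x \<in> U \<union> W" "y \<in> U \<union> W"
        "poly_fun_mod f (p ^ r) x = poly_fun_mod f (p ^ r) y"
      then have dvd: "int p ^ r dvd poly f x - poly f y"
        by (simp add: poly_fun_mod_eq_iff)
      \<comment> \<open>As \<open>f\<close> is the identity modulo \<open>p\<close>, no point of
        \<open>U\<close> can collide with one of \<open>W\<close>.\<close>
      then have dvd_iff: "int p dvd x \<longleftrightarrow> int p dvd y"
        using dvd_add_left_iff[OF inj_mod_p[OF dvd], of y] by simp
      show "x = y"
      proof (cases "int p dvd y")
        case True
        then obtain s t where st: "x = int p * s" "y = int p * t"
            "s \<in> {0..<int (p ^ (r - 2))}" "t \<in> {0..<int (p ^ (r - 2))}"
          using xy(1,2) dvd_iff unfolding U_def W_def by blast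
        then have "int (p ^ (r - 2)) dvd s - t"
          using inj_W dvd by simp
        then show ?thesis
          using st Zmod_eqI[of s "p ^ (r - 2)" t] by (simp add: carrier_residue_ring)
      next
        case False
        then have "int (p ^ r) dvd x - y"
          using inj_U dvd by simp
        then show ?thesis
          using xy W_sub by (intro Zmod_eqI[of x "p ^ r" y]) (auto simp: U_def)
      qed
    qed
    then have "card (U \<union> W) \<le> num_values f (p ^ r)"
      using W_sub by (intro num_values_ge_card) (auto simp: U_def)
    moreover have "finite U" "finite W"
      unfolding U_def W_def carrier_residue_ring
      by (rule finite_subset[of _ "{0..<int (p ^ r)}"]; auto) simp
    then have "card (U \<union> W) = card U + card W"
      by (rule card_Un_disjoint) (auto simp: U_def W_def)
    moreover have "card U = p ^ r - p ^ (r - 1)"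
      unfolding U_def using p assms(2) by (intro card_Zmod_prime_power_units) auto
    moreover have "card W = p ^ (r - 2)"
      unfolding W_def using p by (subst card_image) (auto simp: inj_on_def nat_power_eq)
    moreover have "p ^ r - p ^ (r - 1) + p ^ (r - 2) = p ^ (r - 2) * (p ^ 2 - p + 1)"
      unfolding pr by (simp only: mult.commute[of "p ^ (r - 2)"] diff_mult_distrib add_mult_distrib mult_1_left)
    ultimately show "p ^ (r - 2) * (p ^ 2 - p + 1) \<le> num_values f (p ^ r)"
      by simp
  qed (rule num_values_prime_power_nonperm_le[OF assms])
qed

theorem theorem1p1:
  fixes p r :: nat
  assumes "prime p" and "r \<ge> 1"
  shows "max_nonperm (p ^ r) = (if r = 1 then p - 1 else p ^ (r - 2) * (p ^ 2 - p + 1))"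
  using max_nonperm_prime[OF assms(1)] max_nonperm_prime_power[OF assms(1), of r] assms(2)
  by (cases "r = 1") auto

end
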